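(* Let $n \ge 1$, let $a_1, \dots, a_n$ be positive integers, let $m := \sum_{i=1}^n a_i$, and let $p := (a_1/m, \dots, a_n/m)$. Let $T$ be the DDG tree of the Fast Loaded Dice Roller (FLDR) for $(a_1,\dots,a_n)$, and let $L_T$ be the (random) total number of fair bits consumed by FLDR until it returns a sample. Then $$0 \le \mathbb{E}[L_T] - H(p) < 6,$$ where $H(p) := \sum_{i=1}^n p_i \log(1/p_i)$ is the Shannon entropy of $p$.
   Context: All logarithms are base 2. DDG trees. A discrete distribution generating (DDG) tree over a finite outcome set $\{1,\dots,N\}$ is a (possibly infinite) rooted binary tree in which every internal node has exactly two children and every leaf is labeled with an element of $\{1,\dots,N\}$ (the tree consisting of a single labeled root is allowed). The root is at level $0$. It represents the following sampling algorithm: starting at the root, while the current node is not a leaf, draw an independent fair bit $B \in \{0,1\}$ and move to the left child if $B=0$ and to the right child if $B=1$; on reaching a leaf, return its label. Writing $d(x)$ for the level of a node $x$, the output distribution gives outcome $i$ probability $\sum_{x \text{ leaf labeled } i} 2^{-d(x)}$, and the expected number of bits consumed is $\mathbb{E}[L_T] = \sum_{x \text{ leaf}} d(x) 2^{-d(x)}$. A DDG tree is entropy-optimal for a probability distribution if this is its output distribution and its expected number of bits consumed is minimal among all DDG trees with the same output distribution. By a known theorem of Knuth and Yao, this means that the tree has exactly one leaf labeled $i$ at level $j$ if the coefficient of $2^{-j}$ in the binary expansion of the probability of $i$ is $1$, and no such leaf if it is $0$ (using the terminating expansion for dyadic rationals). FLDR. Given positive integers $(a_1,\dots,a_n)$ with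 sum $m$, FLDR samples $i$ with probability $a_i/m$ as follows. (1) Let $k := \lceil \log m \rceil$ and define the proposal distribution on $\{1,\dots,n+1\}$ by $q := (a_1/2^k, \dots, a_n/2^k, 1 - m/2^k)$. (2) Sample $X \sim q$ using an entropy-optimal DDG tree $T_q$ for $q$, with fresh independent fair bits. (3) If $X \le n$, return $X$; otherwise go to step (2). The DDG tree $T$ of FLDR is $T_q$ together with a back-edge from each leaf labeled $n+1$ to the root, meaning that on reaching such a leaf the process restarts from the root without drawing a bit. Equivalently, it is the possibly infinite tree obtained by recursively replacing each leaf labeled $n+1$ by a copy of the whole tree. Thus $L_T$ counts the bits consumed over all rounds of step (2) until a value $X \le n$ is returned, which happens with probability one. *)

theory Defs
  imports "HOL-Probability.Probability"
begin

codatatype (labels: 'a) ddg = Leaf 'a | Branch "'a ddg" "'a ddg"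

text \<open>Nodes are addressed by the bits leading to them from the root (\<open>True\<close> is the bit 1 and means
  right); the level of a node is the length of its address.\<close>

primrec subtree :: "'a ddg \<Rightarrow> bool list \<Rightarrow> 'a ddg option" where
  "subtree t [] = Some t"
| "subtree t (b # bs) =
    (case t of Leaf _ \<Rightarrow> None | Branch l r \<Rightarrow> subtree (if b then r else l) bs)"

definition leaves :: "'a ddg \<Rightarrow> 'a \<Rightarrow> bool list set" where
  "leaves t i = {w. subtree t w = Some (Leaf i)}"

definition coin_flips :: "bool stream measure" where
  "coin_flips = stream_space (measure_pmf (bernoulli_pmf (1/2)))"

text \<open>The sampling algorithm on a stream of flips. It reads the shortest prefix that is the address
  of a leaf, and infinitely many bits if there is no such prefix (the infimum of the empty set is
  \<open>\<infinity>\<close>).\<close>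

definition returns :: "'a ddg \<Rightarrow> 'a \<Rightarrow> bool stream \<Rightarrow> bool" where
  "returns t i \<omega> \<longleftrightarrow> (\<exists>j. stake j \<omega> \<in> leaves t i)"

definition bits_consumed :: "'a ddg \<Rightarrow> bool stream \<Rightarrow> enat" where
  "bits_consumed t \<omega> = (INF j \<in> {j. \<exists>i. stake j \<omega> \<in> leaves t i}. enat j)"

definition output_prob :: "'a ddg \<Rightarrow> 'a \<Rightarrow> real" where
  "output_prob t i = measure coin_flips {\<omega>. returns t i \<omega>}"

definition expected_bits :: "'a ddg \<Rightarrow> ennreal" where
  "expected_bits t = (\<integral>\<^sup>+\<omega>. ennreal_of_enat (bits_consumed t \<omega>) \<partial>coin_flips)"

definition entropy_optimal :: "nat \<Rightarrow> (nat \<Rightarrow> real) \<Rightarrow> nat ddg \<Rightarrow> bool" where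
  "entropy_optimal N q t \<longleftrightarrow>
     labels t \<subseteq> {1..N} \<and> (\<forall>i\<in>{1..N}. output_prob t i = q i) \<and>
     (\<forall>t'. labels t' \<subseteq> {1..N} \<longrightarrow> (\<forall>i\<in>{1..N}. output_prob t' i = q i) \<longrightarrow>
       expected_bits t \<le> expected_bits t')"

definition fldr_proposal :: "nat \<Rightarrow> (nat \<Rightarrow> nat) \<Rightarrow> nat \<Rightarrow> real" where
  "fldr_proposal n a i =
     (let m = (\<Sum>j=1..n. a j); k = nat \<lceil>log 2 (real m)\<rceil>
      in if i \<le> n then real (a i) / 2 ^ k else 1 - real m / 2 ^ k)"

text \<open>\<open>restart r R t\<close> replaces each leaf of \<open>t\<close> labelled \<open>r\<close>, recursively, by a copy of \<open>R\<close>. Restarting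
  once before consuming the next bit suffices unless \<open>R = Leaf r\<close>. This case does not arise for
  FLDR, where the restart probability \<open>1 - m / 2^k\<close> is less than \<open>1/2\<close>.\<close>

primcorec restart :: "'a \<Rightarrow> 'a ddg \<Rightarrow> 'a ddg \<Rightarrow> 'a ddg" where
  "restart r R t =
     (case (if t = Leaf r then R else t) of
        Leaf i \<Rightarrow> Leaf i
      | Branch t1 t2 \<Rightarrow> Branch (restart r R t1) (restart r R t2))"

definition fldr_tree :: "nat \<Rightarrow> nat ddg \<Rightarrow> nat ddg" where
  "fldr_tree n Tq = restart (n + 1) Tq Tq"

definition shannon_entropy :: "nat \<Rightarrow> (nat \<Rightarrow> real) \<Rightarrow> real" where
  "shannon_entropy n p = (\<Sum>i=1..n. p i * log 2 (1 / p i))"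

lemma space_coin_flips[simp]: "space coin_flips = UNIV"
  by (simp add: coin_flips_def space_stream_space)

lemma sets_coin_flips[measurable_cong]: "sets coin_flips = sets (stream_space (count_space UNIV))"
  unfolding coin_flips_def by (rule sets_stream_space_cong) simp

lemma prob_space_coin_flips: "prob_space coin_flips"
  unfolding coin_flips_def by (rule prob_space.prob_space_stream_space[OF prob_space_measure_pmf])

lemma sets_stake[measurable]: "{\<omega>. stake j \<omega> \<in> A} \<in> sets coin_flips"
proof -
  have "stake j -` A \<inter> space coin_flips \<in> sets coin_flips"
    by (rule measurable_sets[where A="count_space UNIV"]) measurable
  then show ?thesis by (simp add: vimage_def)
qed

lemma emeasure_cylinder: "emeasure coin_flips {\<omega>. stake (length w) \<omega> = w} = (1/2) ^ length w"
proof (induction w)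
  case Nil
  then show ?case using prob_space.emeasure_space_1[OF prob_space_coin_flips] by simp
next
  case (Cons b w)
  have m: "{\<omega>. stake (length (b # w)) \<omega> = b # w}
      \<in> sets (stream_space (measure_pmf (bernoulli_pmf (1/2))))"
    using sets_stake[of "length (b # w)" "{b # w}"] by (simp add: coin_flips_def)
  have eq: "emeasure coin_flips {\<omega>. stake (length (b # w)) (x ## \<omega>) = b # w}
      = indicator {b} x * (1/2) ^ length w" for x
    using Cons by (cases "x = b") auto
  have half: "emeasure (measure_pmf (bernoulli_pmf (1/2))) {b} = 1/2"
    by (cases b) (simp_all add: emeasure_pmf_single ennreal_divide_numeral flip: ennreal_1)
  have "emeasure coin_flips {\<omega>. stake (length (b # w)) \<omega> = b # w}
      = (\<integral>\<^sup>+x. indicator {b} x * (1/2) ^ length w \<partial>bernoulli_pmf (1/2))"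
    unfolding eq[symmetric] unfolding coin_flips_def
    by (subst prob_space.emeasure_stream_space[OF prob_space_measure_pmf m])
      (simp only: space_stream_space space_measure_pmf streams_UNIV mem_Collect_eq UNIV_I simp_thms)
  also have "\<dots> = (\<integral>\<^sup>+x. indicator {b} x \<partial>bernoulli_pmf (1/2)) * (1/2) ^ length w"
    by (rule nn_integral_multc) simp
  also have "\<dots> = (1/2) ^ length (b # w)"
    by (simp only: nn_integral_indicator sets_measure_pmf UNIV_I half power_Suc list.size
        add_0_right add_Suc_right)
  finally show ?case .
qed

lemma subtree_append:
  "subtree t (u @ v) = (case subtree t u of None \<Rightarrow> None | Some s \<Rightarrow> subtree s v)"
  by (induction u arbitrary: t) (auto split: ddg.splits)

lemma leaf_prefix_unique:
  assumes "stake j \<omega> \<in> leaves t i" "stake j' \<omega> \<in> leaves t i'"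
  shows "j = j'" "i = i'"
proof -
  have *: "j' = j" if "stake j \<omega> \<in> leaves t i" "stake j' \<omega> \<in> leaves t i'" "j \<le> j'" for j j' i i'
  proof -
    obtain d where d: "j' = j + d" using \<open>j \<le> j'\<close> le_Suc_ex by blast
    have "stake j' \<omega> = stake j \<omega> @ stake d (sdrop j \<omega>)" unfolding d by (rule stake_add[symmetric])
    then have "subtree (Leaf i) (stake d (sdrop j \<omega>)) = Some (Leaf i')"
      using that(1,2) unfolding leaves_def mem_Collect_eq by (simp only: subtree_append option.case)
    then show ?thesis using d by (cases d) auto
  qed
  show "j = j'" using * assms by (metis nle_le)
  then show "i = i'" using assms by (simp add: leaves_def)
qed

lemma output_prob_eq_leaf_sum:
  "ennreal (output_prob t i) = (\<integral>\<^sup>+w. (1/2) ^ length w \<partial>count_space (leaves t i))"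
proof -
  let ?C = "\<lambda>w. {\<omega>. stake (length w) \<omega> = w}"
  have C: "?C w \<in> sets coin_flips" for w using sets_stake[of "length w" "{w}"] by simp
  interpret prob_space coin_flips by (rule prob_space_coin_flips)
  have eq: "{\<omega>. returns t i \<omega>} = (\<Union>w\<in>leaves t i. ?C w)"
  proof (intro equalityI subsetI)
    fix \<omega> assume "\<omega> \<in> {\<omega>. returns t i \<omega>}"
    then obtain j where "stake j \<omega> \<in> leaves t i" by (auto simp: returns_def)
    then show "\<omega> \<in> (\<Union>w\<in>leaves t i. ?C w)" by (intro UN_I[of "stake j \<omega>"]) simp_all
  next
    fix \<omega> assume "\<omega> \<in> (\<Union>w\<in>leaves t i. ?C w)"
    then obtain w where "w \<in> leaves t i" "stake (length w) \<omega> = w" by blast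
    then show "\<omega> \<in> {\<omega>. returns t i \<omega>}"
      unfolding returns_def mem_Collect_eq by (intro exI[of _ "length w"]) simp
  qed
  have dis: "disjoint_family_on ?C (leaves t i)"
    unfolding disjoint_family_on_def
  proof (intro ballI impI, rule ccontr)
    fix v w assume vw: "v \<in> leaves t i" "w \<in> leaves t i" "v \<noteq> w" "?C v \<inter> ?C w \<noteq> {}"
    then obtain \<omega> where \<omega>: "stake (length v) \<omega> = v" "stake (length w) \<omega> = w" by blast
    have "length v = length w"
      by (rule leaf_prefix_unique(1)[of _ \<omega> t i _ i]) (simp_all only: \<omega> vw(1,2))
    then have "v = w" using \<omega> by metis
    then show False using vw(3) by simp
  qed
  show ?thesis
    unfolding output_prob_def emeasure_eq_measure[symmetric] eq
    by (subst emeasure_UN_countable) (use C dis in \<open>auto simp: emeasure_cylinder\<close>)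
qed

lemma AE_terminates:
  fixes t :: "nat ddg"
  assumes "labels t \<subseteq> {1..N}" "(\<Sum>i=1..N. output_prob t i) = 1"
  shows "AE \<omega> in coin_flips. \<exists>i. returns t i \<omega>"
proof -
  interpret prob_space coin_flips by (rule prob_space_coin_flips)
  have m: "{\<omega>. returns t i \<omega>} \<in> sets coin_flips" for i
  proof -
    have "{\<omega>. returns t i \<omega>} = (\<Union>j. {\<omega>. stake j \<omega> \<in> leaves t i})" by (auto simp: returns_def)
    then show ?thesis by auto
  qed
  have "prob (\<Union>i\<in>{1..N}. {\<omega>. returns t i \<omega>}) = (\<Sum>i=1..N. output_prob t i)"
    unfolding output_prob_def
  proof (rule finite_measure_finite_Union)
    show "disjoint_family_on (\<lambda>i. {\<omega>. returns t i \<omega>}) {1..N}"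
      unfolding disjoint_family_on_def returns_def
    proof (intro ballI impI equals0I)
      fix i i' \<omega> assume "i \<noteq> i'"
        "\<omega> \<in> {\<omega>. \<exists>j. stake j \<omega> \<in> leaves t i} \<inter> {\<omega>. \<exists>j. stake j \<omega> \<in> leaves t i'}"
      then obtain j j' where "stake j \<omega> \<in> leaves t i" "stake j' \<omega> \<in> leaves t i'" by blast
      from leaf_prefix_unique(2)[OF this] show False using \<open>i \<noteq> i'\<close> by simp
    qed
  qed (use m in auto)
  then have "AE \<omega> in coin_flips. \<omega> \<in> (\<Union>i\<in>{1..N}. {\<omega>. returns t i \<omega>})"
    using assms m by (subst prob_eq_1[symmetric]) auto
  then show ?thesis by eventually_elim auto
qed

lemma expected_bits_eq_leaf_sum:
  fixes t :: "nat ddg"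
  assumes "labels t \<subseteq> {1..N}" "(\<Sum>i=1..N. output_prob t i) = 1"
  shows "expected_bits t =
    (\<integral>\<^sup>+w. of_nat (length w) * (1/2) ^ length w \<partial>count_space (\<Union>i. leaves t i))"
proof -
  let ?C = "\<lambda>w. {\<omega>. stake (length w) \<omega> = w}" and ?L = "\<Union>i. leaves t i"
  have C[measurable]: "?C w \<in> sets coin_flips" for w
    using sets_stake[of "length w" "{w}"] by simp
  have "AE \<omega> in coin_flips. ennreal_of_enat (bits_consumed t \<omega>)
      = (\<integral>\<^sup>+w. of_nat (length w) * indicator (?C w) \<omega> \<partial>count_space ?L)"
    using AE_terminates[OF assms]
  proof eventually_elim
    case (elim \<omega>)
    then obtain i j where ij: "stake j \<omega> \<in> leaves t i" by (auto simp: returns_def)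
    have "{j. \<exists>i. stake j \<omega> \<in> leaves t i} = {j}" by (use ij leaf_prefix_unique(1)[OF ij] in blast)
    then have b: "bits_consumed t \<omega> = enat j" by (simp add: bits_consumed_def)
    have "(\<integral>\<^sup>+w. of_nat (length w) * indicator (?C w) \<omega> \<partial>count_space ?L)
        = (\<integral>\<^sup>+w. of_nat j * indicator {stake j \<omega>} w \<partial>count_space ?L)"
    proof (rule nn_integral_cong)
      fix w assume "w \<in> space (count_space ?L)"
      then obtain i' where "w \<in> leaves t i'" by auto
      then have "stake (length w) \<omega> = w \<longleftrightarrow> w = stake j \<omega>"
        using leaf_prefix_unique(1)[OF ij, of "length w" i'] length_stake by metis
      then show "of_nat (length w) * indicator (?C w) \<omega>
          = (of_nat j * indicator {stake j \<omega>} w :: ennreal)"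
        by (cases "w = stake j \<omega>") simp_all
    qed
    also have "\<dots> = of_nat j * emeasure (count_space ?L) {stake j \<omega>}"
      using ij by (intro nn_integral_cmult_indicator) auto
    also have "\<dots> = of_nat j" using ij by (subst emeasure_count_space) auto
    finally show ?case by (simp add: b ennreal_of_enat_enat)
  qed
  then have "expected_bits t
      = (\<integral>\<^sup>+\<omega>. \<integral>\<^sup>+w. of_nat (length w) * indicator (?C w) \<omega> \<partial>count_space ?L \<partial>coin_flips)"
    unfolding expected_bits_def by (rule nn_integral_cong_AE)
  also have "\<dots>
      = (\<integral>\<^sup>+w. \<integral>\<^sup>+\<omega>. of_nat (length w) * indicator (?C w) \<omega> \<partial>coin_flips \<partial>count_space ?L)"
    by (rule nn_integral_count_space_nn_integral) auto
  also have "\<dots> = (\<integral>\<^sup>+w. of_nat (length w) * (1/2) ^ length w \<partial>count_space ?L)"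
    by (intro nn_integral_cong) (simp add: nn_integral_cmult_indicator emeasure_cylinder)
  finally show ?thesis .
qed

end

theory Submission
  imports Defs
begin

text \<open>Each leaf labelled \<open>i\<close> of a tree with output distribution \<open>p\<close> has probability \<open>2 ^ - d \<le> p i\<close>,
  so its level \<open>d\<close> is at least \<open>log 2 (1 / p i)\<close>; averaging gives the lower bound. For the upper bound
  write \<open>Q = 2 ^ k < 2 * m\<close>. Wald's identity for the restarts gives \<open>m * E[L\<^sub>T] = Q * E[L\<^sub>q]\<close>. By optimality
  \<open>E[L\<^sub>q]\<close> is at most the cost of any tree with output distribution \<open>q\<close>, and a bottom-up construction
  yields one of cost at most \<open>H(q) + 2\<close>. The chain rule \<open>Q * H(q) = m * H(p) + Q * h(m / Q)\<close> and
  \<open>h \<le> 1\<close> for the binary entropy \<open>h\<close> bound the toll by \<open>3 * Q / m < 6\<close>.\<close>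

subsection \<open>Sums over sets of words\<close>

lemma nn_integral_count_space_disjoint_Un:
  fixes f :: "'a \<Rightarrow> ennreal"
  assumes "A \<inter> B = {}"
  shows "(\<integral>\<^sup>+x. f x \<partial>count_space (A \<union> B)) = (\<integral>\<^sup>+x. f x \<partial>count_space A) + (\<integral>\<^sup>+x. f x \<partial>count_space B)"
  using nn_integral_disjoint_pair_countspace[OF assms, of f]
  by (simp add: nn_integral_count_space_indicator)

lemma nn_integral_count_space_inj_image:
  assumes "inj_on g A"
  shows "(\<integral>\<^sup>+x. f x \<partial>count_space (g ` A)) = (\<integral>\<^sup>+x. f (g x) \<partial>count_space A)"
  using nn_integral_bij_count_space[OF inj_on_imp_bij_betw[OF assms], of f] by simp

lemma nn_integral_count_space_disjoint_UN:
  fixes f :: "'a \<Rightarrow> ennreal"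
  assumes "finite I" "disjoint_family_on A I"
  shows "(\<integral>\<^sup>+x. f x \<partial>count_space (\<Union>i\<in>I. A i)) = (\<Sum>i\<in>I. \<integral>\<^sup>+x. f x \<partial>count_space (A i))"
  using assms
proof (induction I)
  case (insert i I)
  then have "A i \<inter> (\<Union>j\<in>I. A j) = {}" by (auto simp: disjoint_family_on_def)
  moreover have "disjoint_family_on A I" using insert.prems by (rule disjoint_family_on_mono[rotated]) auto
  ultimately show ?case using insert by (simp add: nn_integral_count_space_disjoint_Un)
qed (simp add: nn_integral_empty)

text \<open>For a prefix-free set this is the probability that the flips begin with one of its
  words, since a cylinder over a word of length \<open>l\<close> has probability
  \<open>(1/2) ^ l\<close>.\<close>

definition word_mass :: "bool list set \<Rightarrow> ennreal" where
  "word_mass A = (\<integral>\<^sup>+w. (1/2) ^ length w \<partial>count_space A)"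

definition word_depth :: "bool list set \<Rightarrow> ennreal" where
  "word_depth A = (\<integral>\<^sup>+w. of_nat (length w) * (1/2) ^ length w \<partial>count_space A)"

lemma word_mass_Un: "A \<inter> B = {} \<Longrightarrow> word_mass (A \<union> B) = word_mass A + word_mass B"
  by (simp add: word_mass_def nn_integral_count_space_disjoint_Un)

lemma word_depth_Un: "A \<inter> B = {} \<Longrightarrow> word_depth (A \<union> B) = word_depth A + word_depth B"
  by (simp add: word_depth_def nn_integral_count_space_disjoint_Un)

lemma word_mass_Cons: "word_mass ((#) b ` A) = (1/2) * word_mass A"
  by (simp add: word_mass_def nn_integral_count_space_inj_image nn_integral_cmult)

text \<open>The new first bit halves every weight and adds 1 to every length; the added 1 brings in
  the mass of \<open>A\<close>.\<close>

lemma word_depth_Cons: "word_depth ((#) b ` A) = (1/2) * (word_mass A + word_depth A)"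
proof -
  have eq: "of_nat (Suc k) * (h * x) = h * (x + of_nat k * x)" for h x :: ennreal and k
    by (simp add: algebra_simps)
  have "word_depth ((#) b ` A) =
      (\<integral>\<^sup>+w. (1/2) * ((1/2) ^ length w + of_nat (length w) * (1/2) ^ length w) \<partial>count_space A)"
    by (simp only: word_depth_def nn_integral_count_space_inj_image inj_on_Cons1 list.size(4)
        One_nat_def add_Suc_right add_0_right power_Suc eq)
  then show ?thesis
    by (simp add: word_depth_def word_mass_def nn_integral_cmult nn_integral_add)
qed

text \<open>Unique factorisation turns the sum over concatenations into a sum over pairs, and
  Tonelli makes it an iterated sum.\<close>

lemma nn_integral_count_space_concat:
  fixes g :: "'b::countable list \<Rightarrow> ennreal"
  assumes "inj_on (\<lambda>(v, u). v @ u) (B \<times> L)"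
  shows "(\<integral>\<^sup>+w. g w \<partial>count_space ((\<lambda>(v, u). v @ u) ` (B \<times> L)))
    = (\<integral>\<^sup>+v. \<integral>\<^sup>+u. g (v @ u) \<partial>count_space L \<partial>count_space B)"
proof -
  interpret sigma_finite_measure "count_space L"
    by (rule sigma_finite_measure_count_space_countable) simp
  have "(\<integral>\<^sup>+w. g w \<partial>count_space ((\<lambda>(v, u). v @ u) ` (B \<times> L)))
    = (\<integral>\<^sup>+x. (\<lambda>(v, u). g (v @ u)) x \<partial>(count_space B \<Otimes>\<^sub>M count_space L))"
    by (subst nn_integral_count_space_inj_image[OF assms])
      (simp add: pair_measure_countable split_def)
  also have "\<dots> = (\<integral>\<^sup>+v. \<integral>\<^sup>+u. g (v @ u) \<partial>count_space L \<partial>count_space B)"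
    by (subst nn_integral_fst[symmetric]) (simp_all add: pair_measure_countable)
  finally show ?thesis .
qed

lemma word_mass_concat:
  assumes "inj_on (\<lambda>(v, u). v @ u) (B \<times> L)"
  shows "word_mass ((\<lambda>(v, u). v @ u) ` (B \<times> L)) = word_mass B * word_mass L"
  unfolding word_mass_def nn_integral_count_space_concat[OF assms]
  by (simp add: power_add nn_integral_cmult nn_integral_multc)

text \<open>Truncating the depth keeps the recursion solvable before it is known that the depth is finite.\<close>

definition trunc_depth :: "nat \<Rightarrow> bool list set \<Rightarrow> ennreal" where
  "trunc_depth N A = (\<integral>\<^sup>+w. of_nat (min (length w) N) * (1/2) ^ length w \<partial>count_space A)"

lemma trunc_depth_le: "trunc_depth N A \<le> of_nat N * word_mass A"
  unfolding trunc_depth_def word_mass_def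
  by (subst nn_integral_cmult[symmetric]) (auto intro!: nn_integral_mono mult_right_mono)

lemma trunc_depth_le_word_depth: "trunc_depth N A \<le> word_depth A"
  unfolding trunc_depth_def word_depth_def
  by (auto intro!: nn_integral_mono mult_right_mono)

lemma SUP_trunc_depth: "(SUP N. trunc_depth N A) = word_depth A"
proof -
  have "(SUP N. of_nat (min (length w) N) * (1/2) ^ length w)
      = (of_nat (length w) * (1/2) ^ length w :: ennreal)" for w :: "bool list"
    by (rule antisym) (auto intro!: SUP_least SUP_upper2[of "length w"] mult_right_mono)
  then show ?thesis
    unfolding trunc_depth_def word_depth_def
    by (subst nn_integral_monotone_convergence_SUP[symmetric])
      (auto simp: incseq_def le_fun_def intro!: mult_right_mono)
qed

lemma trunc_depth_Un: "A \<inter> B = {} \<Longrightarrow> trunc_depth N (A \<union> B) = trunc_depth N A + trunc_depth N B"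
  by (simp add: trunc_depth_def nn_integral_count_space_disjoint_Un)

text \<open>Under concatenation lengths add and weights multiply, so the depth obeys a product
  rule.\<close>

lemma word_depth_concat:
  assumes "inj_on (\<lambda>(v, u). v @ u) (B \<times> L)"
  shows "word_depth ((\<lambda>(v, u). v @ u) ` (B \<times> L))
    = word_depth B * word_mass L + word_mass B * word_depth L"
proof -
  have "word_depth ((\<lambda>(v, u). v @ u) ` (B \<times> L)) =
    (\<integral>\<^sup>+v. \<integral>\<^sup>+u. of_nat (length v) * (1/2) ^ length v * (1/2) ^ length u
        + (1/2) ^ length v * (of_nat (length u) * (1/2) ^ length u) \<partial>count_space L \<partial>count_space B)"
    unfolding word_depth_def nn_integral_count_space_concat[OF assms]
    by (simp add: power_add algebra_simps)
  then show ?thesis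
    by (simp add: word_depth_def word_mass_def nn_integral_add nn_integral_cmult nn_integral_multc)
qed

text \<open>Since \<open>min (k + l) N \<le> k + min l N\<close>, it suffices to truncate the second
  factor. The truncated depth of \<open>L\<close> thus recurs on the right, multiplied by the mass
  of \<open>B\<close>.\<close>

lemma trunc_depth_concat_le:
  assumes "inj_on (\<lambda>(v, u). v @ u) (B \<times> L)"
  shows "trunc_depth N ((\<lambda>(v, u). v @ u) ` (B \<times> L))
    \<le> word_depth B * word_mass L + word_mass B * trunc_depth N L"
proof -
  have "of_nat (min (length (v @ u)) N) * (1/2) ^ length (v @ u)
      \<le> (of_nat (length v) * (1/2) ^ length v * (1/2) ^ length u
        + (1/2) ^ length v * (of_nat (min (length u) N) * (1/2) ^ length u) :: ennreal)"
    for v u :: "bool list"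
  proof -
    have eq: "of_nat (k + l) * (x * y) = of_nat k * x * y + x * (of_nat l * y)"
      for x y :: ennreal and k l by (simp add: algebra_simps)
    have "of_nat (min (length (v @ u)) N) * (1/2) ^ length (v @ u)
        \<le> (of_nat (length v + min (length u) N) * (1/2) ^ length (v @ u) :: ennreal)"
      by (intro mult_right_mono of_nat_mono) auto
    then show ?thesis by (simp only: length_append power_add eq)
  qed
  then have "trunc_depth N ((\<lambda>(v, u). v @ u) ` (B \<times> L)) \<le>
    (\<integral>\<^sup>+v. \<integral>\<^sup>+u. of_nat (length v) * (1/2) ^ length v * (1/2) ^ length u
        + (1/2) ^ length v * (of_nat (min (length u) N) * (1/2) ^ length u) \<partial>count_space L \<partial>count_space B)"
    unfolding trunc_depth_def nn_integral_count_space_concat[OF assms]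
    by (intro nn_integral_mono)
  then show ?thesis
    by (simp add: word_depth_def word_mass_def trunc_depth_def nn_integral_add nn_integral_cmult nn_integral_multc)
qed

text \<open>Wald's identity for restarting: a run of the whole process is either a run ending in \<open>A\<close> or a
  run ending in \<open>B\<close> followed by an independent copy of the process.\<close>

lemma word_depth_renewal:
  assumes inj: "inj_on (\<lambda>(v, u). v @ u) (B \<times> L)"
    and L: "L = A \<union> (\<lambda>(v, u). v @ u) ` (B \<times> L)"
    and disj: "A \<inter> (\<lambda>(v, u). v @ u) ` (B \<times> L) = {}"
    and mass: "word_mass L = 1" and r: "word_mass B = ennreal r" "0 \<le> r" "r < 1"
    and d: "word_depth A + word_depth B = ennreal d" "0 \<le> d"
  shows "word_depth L = ennreal (d / (1 - r))"
proof -
  let ?BL = "(\<lambda>(v, u). v @ u) ` (B \<times> L)"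
  have bound: "trunc_depth N L \<le> ennreal (d / (1 - r))" for N
  proof -
    have "trunc_depth N L < \<top>"
      using trunc_depth_le[of N L] mass by (simp add: order_le_less_trans of_nat_less_top)
    then obtain s where s: "trunc_depth N L = ennreal s" "0 \<le> s" by (cases "trunc_depth N L") auto
    have "trunc_depth N L = trunc_depth N A + trunc_depth N ?BL"
      by (subst L) (rule trunc_depth_Un[OF disj])
    also have "\<dots> \<le> word_depth A + (word_depth B * word_mass L + word_mass B * trunc_depth N L)"
      by (intro add_mono trunc_depth_le_word_depth trunc_depth_concat_le inj)
    also have "\<dots> = ennreal (d + r * s)"
      using d s r by (simp add: mass ennreal_mult flip: add.assoc)
    finally have "s \<le> d + r * s" using s d r by (simp del: ennreal_plus)
    then have "s \<le> d / (1 - r)" using r by (simp add: field_simps)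
    then show ?thesis using s by (simp add: ennreal_leI)
  qed
  \<comment> \<open>The bound is the same for every truncation level, so the depth itself is finite.
    Only now may the exact renewal equation be solved in the reals.\<close>
  have "word_depth L \<le> ennreal (d / (1 - r))"
    unfolding SUP_trunc_depth[symmetric] by (rule SUP_least) (rule bound)
  then obtain s where s: "word_depth L = ennreal s" "0 \<le> s"
    by (cases "word_depth L") (auto simp: top_unique)
  have "word_depth L = word_depth A + word_depth ?BL"
    by (subst L) (rule word_depth_Un[OF disj])
  also have "\<dots> = word_depth A + (word_depth B + word_mass B * word_depth L)"
    by (simp add: word_depth_concat[OF inj] mass)
  also have "\<dots> = ennreal (d + r * s)"
    using d s r by (simp add: ennreal_mult flip: add.assoc)
  finally have "s = d + r * s" using s d r by (simp del: ennreal_plus)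
  then have "s = d / (1 - r)" using r by (simp add: field_simps)
  then show ?thesis using s by simp
qed

subsection \<open>Leaves of trees and of restarted trees\<close>

lemma leaves_Leaf: "leaves (Leaf j) i = (if i = j then {[]} else {})"
proof -
  have "subtree (Leaf j) w = Some (Leaf i) \<longleftrightarrow> w = [] \<and> i = j" for w by (cases w) auto
  then show ?thesis by (auto simp: leaves_def)
qed

lemma Nil_notin_leaves_Branch: "[] \<notin> leaves (Branch l r) i"
  by (simp add: leaves_def)

lemma Cons_in_leaves_Branch: "b # w \<in> leaves (Branch l r) i \<longleftrightarrow> w \<in> leaves (if b then r else l) i"
  by (simp add: leaves_def)

lemma leaves_Branch: "leaves (Branch l r) i = (#) False ` leaves l i \<union> (#) True ` leaves r i"
proof (rule set_eqI)
  fix w show "w \<in> leaves (Branch l r) i \<longleftrightarrow> w \<in> (#) False ` leaves l i \<union> (#) True ` leaves r i"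
    by (cases w) (auto simp: Nil_notin_leaves_Branch Cons_in_leaves_Branch image_iff split: if_splits)
qed

text \<open>The subtree at \<open>v\<close> is a leaf, and the only address inside a leaf is
  \<open>[]\<close>.\<close>

lemma leaves_prefix_free:
  assumes "v \<in> leaves t i" "v @ u \<in> leaves t j"
  shows "u = []" "i = j"
proof -
  have "subtree (Leaf i) u = Some (Leaf j)" using assms by (simp add: leaves_def subtree_append)
  then show "u = []" "i = j" by (cases u; simp)+
qed

lemma disjoint_family_leaves: "disjoint_family_on (leaves t) I"
  unfolding disjoint_family_on_def using leaves_prefix_free(2)[of _ t _ "[]"] by fastforce

lemma labels_iff_leaves: "i \<in> labels t \<longleftrightarrow> leaves t i \<noteq> {}"
proof
  assume "i \<in> labels t"
  then show "leaves t i \<noteq> {}"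
    by (induction rule: ddg.set_induct) (auto simp: leaves_Leaf leaves_Branch)
next
  have "w \<in> leaves t i \<Longrightarrow> i \<in> labels t" for w
  proof (induction w arbitrary: t)
    case Nil
    then show ?case by (simp add: leaves_def)
  next
    case (Cons b w)
    then show ?case by (cases t) (auto simp: leaves_Leaf Cons_in_leaves_Branch split: if_splits)
  qed
  then show "leaves t i \<noteq> {} \<Longrightarrow> i \<in> labels t" by blast
qed

lemma output_prob_eq_word_mass: "ennreal (output_prob t i) = word_mass (leaves t i)"
  by (simp add: output_prob_eq_leaf_sum word_mass_def)

lemma output_prob_nonneg: "0 \<le> output_prob t i"
  by (simp add: output_prob_def)

lemma output_prob_Leaf: "output_prob (Leaf j) i = (if i = j then 1 else 0)"
proof -
  have "ennreal (output_prob (Leaf j) i) = ennreal (if i = j then 1 else 0)"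
    unfolding output_prob_eq_word_mass leaves_Leaf word_mass_def
    by (simp add: nn_integral_empty nn_integral_count_space_finite)
  then show ?thesis by (subst (asm) ennreal_inj) (auto simp: output_prob_nonneg)
qed

lemma ennreal_half: "(1/2 :: ennreal) = ennreal (1/2)"
  by (simp add: ennreal_divide_numeral flip: ennreal_1)

lemma output_prob_Branch: "output_prob (Branch l r) i = (output_prob l i + output_prob r i) / 2"
proof -
  have "ennreal (output_prob (Branch l r) i)
      = (1/2) * ennreal (output_prob l i) + (1/2) * ennreal (output_prob r i)"
    unfolding output_prob_eq_word_mass leaves_Branch
    by (subst word_mass_Un) (auto simp: word_mass_Cons)
  also have "\<dots> = ennreal ((output_prob l i + output_prob r i) / 2)"
    by (simp only: ennreal_half ennreal_mult''[symmetric] output_prob_nonneg ennreal_plus[symmetric]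
        mult_nonneg_nonneg divide_nonneg_nonneg zero_le_one zero_le_numeral) (simp add: add_divide_distrib)
  finally show ?thesis by (subst (asm) ennreal_inj) (auto simp: output_prob_nonneg)
qed

lemma UN_leaves:
  assumes "labels t \<subseteq> I"
  shows "(\<Union>i. leaves t i) = (\<Union>i\<in>I. leaves t i)"
  using assms labels_iff_leaves[of _ t] by blast

lemma word_mass_leaves:
  assumes "labels t \<subseteq> I" "finite I"
  shows "word_mass (\<Union>i. leaves t i) = ennreal (\<Sum>i\<in>I. output_prob t i)"
proof -
  have "word_mass (\<Union>i. leaves t i) = (\<Sum>i\<in>I. word_mass (leaves t i))"
    unfolding UN_leaves[OF assms(1)] word_mass_def
    by (rule nn_integral_count_space_disjoint_UN) (use assms disjoint_family_leaves in auto)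
  then show ?thesis by (simp add: output_prob_eq_word_mass[symmetric] sum_ennreal output_prob_nonneg)
qed

section \<open>Almost surely terminating trees and the cost of a branching\<close>

definition terminating :: "nat \<Rightarrow> nat ddg \<Rightarrow> bool" where
  "terminating N t \<longleftrightarrow> labels t \<subseteq> {1..N} \<and> (\<Sum>i=1..N. output_prob t i) = 1"

lemma word_mass_terminating: "terminating N t \<Longrightarrow> word_mass (\<Union>i. leaves t i) = 1"
  by (simp add: terminating_def word_mass_leaves[where I="{1..N}"])

lemma expected_bits_terminating:
  "terminating N t \<Longrightarrow> expected_bits t = word_depth (\<Union>i. leaves t i)"
  unfolding terminating_def word_depth_def by (intro expected_bits_eq_leaf_sum) auto

lemma terminating_Leaf: "j \<in> {1..N} \<Longrightarrow> terminating N (Leaf j)"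
  by (simp add: terminating_def output_prob_Leaf)

lemma expected_bits_Leaf:
  fixes j :: nat
  assumes "j \<in> {1..N}"
  shows "expected_bits (Leaf j) = 0"
proof -
  have "(\<Union>i. leaves (Leaf j) i) = {[]}" by (auto simp: leaves_Leaf)
  then show ?thesis
    by (simp add: expected_bits_terminating[OF terminating_Leaf[OF assms]] word_depth_def
        nn_integral_count_space_finite)
qed

lemma terminating_Branch:
  assumes "terminating N l" "terminating N r"
  shows "terminating N (Branch l r)"
  using assms
  by (simp add: terminating_def output_prob_Branch sum.distrib flip: sum_divide_distrib)

lemma expected_bits_Branch:
  assumes "terminating N l" "terminating N r"
  shows "expected_bits (Branch l r) = 1 + (1/2) * (expected_bits l + expected_bits r)"
proof -
  have eq: "h * (1 + x) + h * (1 + y) = h * (1 + 1) + h * (x + y)" for h x y :: ennreal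
    by (simp only: distrib_left) (simp only: ac_simps)
  have "(\<Union>i. leaves (Branch l r) i) = (#) False ` (\<Union>i. leaves l i) \<union> (#) True ` (\<Union>i. leaves r i)"
    by (auto simp: leaves_Branch)
  then have "expected_bits (Branch l r) = (1/2) * (1 + expected_bits l) + (1/2) * (1 + expected_bits r)"
    unfolding expected_bits_terminating[OF terminating_Branch[OF assms]]
    by (subst \<open>_ = _ \<union> _\<close>, subst word_depth_Un)
      (auto simp: word_depth_Cons word_mass_terminating[OF assms(1)] word_mass_terminating[OF assms(2)]
        expected_bits_terminating[OF assms(1)] expected_bits_terminating[OF assms(2)])
  also have "\<dots> = (1/2) * (1 + 1) + (1/2) * (expected_bits l + expected_bits r)"
    by (rule eq)
  also have "(1/2) * (1 + 1) = (1 :: ennreal)"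
  proof -
    have "(1/2) * (1 + 1) = ennreal (1/2) * ennreal 2"
      by (simp only: ennreal_half one_add_one ennreal_numeral)
    also have "\<dots> = ennreal (1/2 * 2)" by (rule ennreal_mult[symmetric]) auto
    finally show ?thesis by simp
  qed
  finally show ?thesis .
qed

section \<open>Leaves, law and cost of the restarted tree\<close>

lemma restart_Leaf_label: "restart r R (Leaf r) = restart r R R"
  by (subst (1 2) restart.code) simp

lemma restart_Leaf: "j \<noteq> r \<Longrightarrow> restart r R (Leaf j) = Leaf j"
  by (subst restart.code) simp

lemma restart_Branch: "restart r R (Branch t1 t2) = Branch (restart r R t1) (restart r R t2)"
  by (subst restart.code) simp

text \<open>For \<open>R = Leaf r\<close> a leaf labelled \<open>r\<close> survives the restart.\<close>

lemma leaves_restart_label: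
  assumes "R \<noteq> Leaf r"
  shows "leaves (restart r R t) r = {}"
proof -
  have "w \<notin> leaves (restart r R t) r" for w
  proof (induction w arbitrary: t)
    case Nil
    \<comment> \<open>A tree \<open>Leaf r\<close> is replaced by \<open>R\<close>, which differs
      from \<open>Leaf r\<close>; so this case, applied to \<open>t\<close> or to \<open>R\<close>,
      covers everything.\<close>
    have *: "[] \<notin> leaves (restart r R t) r" if "t \<noteq> Leaf r" for t
      using that by (cases t) (auto simp: restart_Leaf restart_Branch leaves_Leaf Nil_notin_leaves_Branch)
    show ?case using *[of t] *[of R] assms by (cases "t = Leaf r") (auto simp: restart_Leaf_label)
  next
    case (Cons b w)
    have *: "b # w \<notin> leaves (restart r R t) r" if "t \<noteq> Leaf r" for t
      using that Cons.IH by (cases t) (auto simp: restart_Leaf restart_Branch leaves_Leaf Cons_in_leaves_Branch)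
    show ?case using *[of t] *[of R] assms by (cases "t = Leaf r") (auto simp: restart_Leaf_label)
  qed
  then show ?thesis by blast
qed

text \<open>The root of a branching is no leaf, so \<open>v\<close> is nonempty and carries the bit
  \<open>b\<close>. The condition on the remainder is left abstract as \<open>P\<close> so that the
  equivalence rewrites under the existential.\<close>

lemma Cons_in_concat_leaves_Branch:
  "(\<exists>v u. b # w = v @ u \<and> v \<in> leaves (Branch l r) i \<and> P u) \<longleftrightarrow>
    (\<exists>v u. w = v @ u \<and> v \<in> leaves (if b then r else l) i \<and> P u)" (is "?L \<longleftrightarrow> ?R")
proof
  assume ?L
  then obtain v u where vu: "b # w = v @ u" "v \<in> leaves (Branch l r) i" "P u" by blast
  then obtain v' where "v = b # v'" by (cases v) (auto simp: Nil_notin_leaves_Branch)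
  with vu have "w = v' @ u" "v' \<in> leaves (if b then r else l) i" by (simp_all add: Cons_in_leaves_Branch)
  with vu(3) show ?R by blast
next
  assume ?R
  then obtain v u where "w = v @ u" "v \<in> leaves (if b then r else l) i" "P u" by blast
  then have "b # w = (b # v) @ u" "b # v \<in> leaves (Branch l r) i" by (simp_all add: Cons_in_leaves_Branch)
  with \<open>P u\<close> show ?L by blast
qed

text \<open>A run from \<open>t\<close> either ends at a leaf of \<open>t\<close> or meets a leaf
  labelled \<open>r\<close> and goes on as a fresh run from \<open>R\<close>. Trees may be infinite,
  so the induction is on the address, with \<open>t\<close> varying and \<open>R\<close>
  fixed.\<close>

lemma in_leaves_restart_iff:
  assumes "i \<noteq> r"
  shows "w \<in> leaves (restart r R t) i \<longleftrightarrow> w \<in> leaves t i \<or>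
    (\<exists>v u. w = v @ u \<and> v \<in> leaves t r \<and> u \<in> leaves (restart r R R) i)"
proof (induction w arbitrary: t)
  case Nil
  show ?case
  proof (cases t)
    case (Leaf j)
    then show ?thesis
      using assms by (cases "j = r") (auto simp: leaves_Leaf restart_Leaf restart_Leaf_label)
  next
    case (Branch t1 t2)
    then show ?thesis by (simp add: Nil_notin_leaves_Branch restart_Branch)
  qed
next
  case (Cons b w)
  show ?case
  proof (cases t)
    case (Leaf j)
    then show ?thesis
      using assms by (cases "j = r") (auto simp: leaves_Leaf restart_Leaf restart_Leaf_label)
  next
    case (Branch t1 t2)
    show ?thesis
      unfolding Branch restart_Branch Cons_in_concat_leaves_Branch Cons_in_leaves_Branch
      by (cases b) (simp_all only: if_True if_False Cons.IH)
  qed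
qed

lemma leaves_restart:
  assumes "i \<noteq> r"
  shows "leaves (restart r R R) i
    = leaves R i \<union> (\<lambda>(v, u). v @ u) ` (leaves R r \<times> leaves (restart r R R) i)"
  using in_leaves_restart_iff[OF assms, of _ R] by (auto simp: image_iff)

text \<open>Two leaf addresses that are prefixes of one word are comparable, hence equal by
  prefix-freeness.\<close>

lemma inj_on_append_leaves: "inj_on (\<lambda>(v, u). v @ u) (leaves t i \<times> L)"
proof (rule inj_onI, clarify)
  fix v u v' u' assume v: "v \<in> leaves t i" "v' \<in> leaves t i" and eq: "v @ u = v' @ u'"
  then have "v = v'"
    using leaves_prefix_free(1)[of v t i _ i] leaves_prefix_free(1)[of v' t i _ i]
    by (auto simp: append_eq_append_conv2)
  then show "v = v' \<and> u = u'" using eq by simp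
qed

lemma leaves_Int_append_leaves:
  "i \<noteq> j \<Longrightarrow> leaves t i \<inter> (\<lambda>(v, u). v @ u) ` (leaves t j \<times> L) = {}"
  using leaves_prefix_free(2)[of _ t j _ i] by auto

text \<open>With \<open>x\<close> the probability sought and \<open>\<rho>\<close> the restart
  probability, splitting on the first round gives \<open>x = output_prob R i + \<rho> * x\<close>,
  solvable because \<open>\<rho> < 1\<close>.\<close>

lemma output_prob_restart:
  assumes "i \<noteq> r" "output_prob R r < 1"
  shows "output_prob (restart r R R) i = output_prob R i / (1 - output_prob R r)"
proof -
  let ?T = "restart r R R"
  have "ennreal (output_prob ?T i) = word_mass (leaves R i) + word_mass (leaves R r) * word_mass (leaves ?T i)"
    unfolding output_prob_eq_word_mass
    by (subst leaves_restart[OF assms(1)])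
      (simp add: word_mass_Un leaves_Int_append_leaves assms(1) word_mass_concat inj_on_append_leaves)
  also have "\<dots> = ennreal (output_prob R i + output_prob R r * output_prob ?T i)"
    by (simp add: output_prob_nonneg ennreal_mult flip: output_prob_eq_word_mass)
  finally have "output_prob ?T i = output_prob R i + output_prob R r * output_prob ?T i"
    by (subst (asm) ennreal_inj) (auto simp: output_prob_nonneg)
  then show ?thesis using assms(2) by (simp add: field_simps)
qed

lemma terminating_restart:
  assumes R: "terminating (Suc n) R" and neq: "R \<noteq> Leaf (Suc n)" and p: "output_prob R (Suc n) < 1"
  shows "terminating n (restart (Suc n) R R)"
  unfolding terminating_def
proof
  show "labels (restart (Suc n) R R) \<subseteq> {1..n}"
  proof
    fix i assume i: "i \<in> labels (restart (Suc n) R R)"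
    then have "i \<noteq> Suc n" by (auto simp: labels_iff_leaves leaves_restart_label[OF neq])
    obtain w where w: "w \<in> leaves (restart (Suc n) R R) i" using i by (auto simp: labels_iff_leaves)
    \<comment> \<open>Each restart uses up at least one bit, because the root of \<open>R\<close> is
      not a restart leaf. Induction on the address length therefore reaches a round that ends at a
      leaf of \<open>R\<close> labelled \<open>i\<close>.\<close>
    have "leaves R i \<noteq> {}"
      using w
    proof (induction "length w" arbitrary: w rule: less_induct)
      case less
      show ?case
      proof (rule ccontr)
        assume e: "\<not> leaves R i \<noteq> {}"
        then obtain v u where vu: "w = v @ u" "v \<in> leaves R (Suc n)" "u \<in> leaves (restart (Suc n) R R) i"
          using less.prems in_leaves_restart_iff[OF \<open>i \<noteq> Suc n\<close>, of w R R] by auto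
        then have "v \<noteq> []" using neq by (auto simp: leaves_def)
        then show False using less.hyps[of u] vu e by auto
      qed
    qed
    then have "i \<in> labels R" by (simp add: labels_iff_leaves)
    then show "i \<in> {1..n}" using R \<open>i \<noteq> Suc n\<close> by (auto simp: terminating_def le_Suc_eq)
  qed
  have "(\<Sum>i=1..n. output_prob (restart (Suc n) R R) i)
      = (\<Sum>i=1..n. output_prob R i / (1 - output_prob R (Suc n)))"
    by (rule sum.cong) (auto simp: output_prob_restart[OF _ p])
  also have "\<dots> = (\<Sum>i=1..n. output_prob R i) / (1 - output_prob R (Suc n))"
    by (simp add: sum_divide_distrib)
  also have "(\<Sum>i=1..n. output_prob R i) = 1 - output_prob R (Suc n)"
    using R by (simp add: terminating_def)
  finally show "(\<Sum>i=1..n. output_prob (restart (Suc n) R R) i) = 1" using p by simp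
qed

text \<open>The number of rounds is geometric with mean
  \<open>1 / (1 - output_prob R (Suc n))\<close>. This is the renewal identity with \<open>A\<close>
  the returning leaves of \<open>R\<close>, \<open>B\<close> its restart leaves and \<open>L\<close>
  all leaves of the restarted tree.\<close>

lemma expected_bits_restart:
  assumes R: "terminating (Suc n) R" and neq: "R \<noteq> Leaf (Suc n)" and p: "output_prob R (Suc n) < 1"
    and fin: "expected_bits R < \<infinity>"
  shows "expected_bits (restart (Suc n) R R)
    = ennreal (enn2real (expected_bits R) / (1 - output_prob R (Suc n)))"
proof -
  let ?T = "restart (Suc n) R R" and ?r = "Suc n"
  let ?A = "\<Union>i\<in>-{?r}. leaves R i" and ?B = "leaves R ?r" and ?L = "\<Union>i. leaves (restart (Suc n) R R) i"
  have T: "terminating n ?T" by (rule terminating_restart[OF R neq p])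
  have drop: "(\<Union>i. F i) = (\<Union>i\<in>-{j}. F i)" if "F j = {}" for F :: "nat \<Rightarrow> bool list set" and j
    using that by fastforce
  have dist: "(\<Union>i\<in>J. F i \<union> g ` (B \<times> G i)) = (\<Union>i\<in>J. F i) \<union> g ` (B \<times> (\<Union>i\<in>J. G i))"
    for J :: "nat set" and F G :: "nat \<Rightarrow> bool list set" and g :: "_ \<Rightarrow> bool list" and B :: "bool list set"
    by blast
  \<comment> \<open>The restarted tree has no leaf labelled \<open>Suc n\<close>. Discarding that
    label leaves only those to which \<open>leaves_restart\<close> applies.\<close>
  have L': "?L = (\<Union>i\<in>-{?r}. leaves ?T i)" by (intro drop leaves_restart_label neq)
  also have "\<dots> = (\<Union>i\<in>-{?r}. leaves R i \<union> (\<lambda>(v, u). v @ u) ` (?B \<times> leaves ?T i))"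
    by (intro SUP_cong refl leaves_restart) auto
  also have "\<dots> = ?A \<union> (\<lambda>(v, u). v @ u) ` (?B \<times> (\<Union>i\<in>-{?r}. leaves ?T i))" by (rule dist)
  also note L'[symmetric]
  finally have L: "?L = ?A \<union> (\<lambda>(v, u). v @ u) ` (?B \<times> ?L)" .
  have disj: "?A \<inter> (\<lambda>(v, u). v @ u) ` (?B \<times> ?L) = {}"
  proof -
    have disjI: "(\<Union>i\<in>J. F i) \<inter> X = {}" if "\<And>i. i \<in> J \<Longrightarrow> F i \<inter> X = {}"
      for J :: "nat set" and F and X :: "bool list set" using that by blast
    show ?thesis by (rule disjI) (rule leaves_Int_append_leaves, simp)
  qed
  have "(\<Union>i. F i) = (\<Union>i\<in>-{j}. F i) \<union> F j" for F :: "nat \<Rightarrow> bool list set" and j by blast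
  note this[of "leaves R" ?r]
  moreover have "?A \<inter> ?B = {}" using disjoint_family_leaves[of R UNIV] by (auto simp: disjoint_family_on_def)
  ultimately have AB: "expected_bits R = word_depth ?A + word_depth ?B"
    by (simp add: expected_bits_terminating[OF R] word_depth_Un)
  show ?thesis
    unfolding expected_bits_terminating[OF T]
    by (rule word_depth_renewal[OF inj_on_append_leaves L disj])
      (use fin p in \<open>auto simp: word_mass_terminating[OF T] output_prob_eq_word_mass[symmetric]
        output_prob_nonneg AB[symmetric] less_top\<close>)
qed

subsection \<open>The entropy bound and trees for dyadic distributions\<close>

lemma entropy_le_expected_bits:
  assumes t: "terminating N t"
  shows "ennreal (shannon_entropy N (output_prob t)) \<le> expected_bits t"
proof -
  have le: "ennreal (output_prob t i * log 2 (1 / output_prob t i)) \<le> word_depth (leaves t i)" for i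
  proof -
    let ?p = "output_prob t i"
    have "ennreal (log 2 (1 / ?p)) \<le> of_nat (length w)" if w: "w \<in> leaves t i" for w
    proof -
      \<comment> \<open>The mass of the leaves labelled \<open>i\<close> dominates its single term
        at \<open>w\<close>.\<close>
      have "(1/2 :: ennreal) ^ length w \<le> ennreal ?p"
        unfolding output_prob_eq_word_mass word_mass_def
        using nn_integral_ge_point[OF w, of "\<lambda>w. (1/2) ^ length w"] by simp
      then have "ennreal ((1/2) ^ length w) \<le> ennreal ?p"
        by (simp only: ennreal_half ennreal_power zero_le_divide_1_iff zero_le_numeral)
      then have "(1/2) ^ length w \<le> ?p" by (simp add: output_prob_nonneg)
      moreover have "0 < (1/2 :: real) ^ length w" by simp
      ultimately have pos: "0 < ?p" by linarith
      with \<open>(1/2) ^ length w \<le> ?p\<close> have "1 / ?p \<le> 2 ^ length w"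
        by (simp add: field_simps power_one_over)
      then have "log 2 (1 / ?p) \<le> log 2 (2 ^ length w)" using pos by (subst log_le_cancel_iff) auto
      also have "\<dots> = real (length w)" by (simp add: log_nat_power)
      finally show ?thesis by (simp add: ennreal_leI flip: ennreal_of_nat_eq_real_of_nat)
    qed
    then have "ennreal (log 2 (1 / ?p)) * word_mass (leaves t i) \<le> word_depth (leaves t i)"
      unfolding word_mass_def word_depth_def
      by (subst nn_integral_cmult[symmetric]) (auto intro!: nn_integral_mono mult_right_mono)
    then show ?thesis
      by (simp add: output_prob_eq_word_mass[symmetric] ennreal_mult' output_prob_nonneg mult.commute)
  qed
  \<comment> \<open>Since \<open>ennreal\<close> sends negative reals to 0, moving it out of the sum
    requires nonnegative summands.\<close>
  have nonneg: "0 \<le> output_prob t i * log 2 (1 / output_prob t i)" for i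
  proof -
    have "output_prob t i \<le> 1"
      unfolding output_prob_def by (rule prob_space.prob_le_1[OF prob_space_coin_flips])
    then show ?thesis using output_prob_nonneg[of t i]
      by (cases "output_prob t i = 0") (auto intro!: mult_nonneg_nonneg simp: zero_le_log_cancel_iff)
  qed
  have "expected_bits t = word_depth (\<Union>i\<in>{1..N}. leaves t i)"
    using t by (simp add: expected_bits_terminating terminating_def UN_leaves[of t "{1..N}"])
  also have "\<dots> = (\<Sum>i=1..N. word_depth (leaves t i))"
    unfolding word_depth_def
    by (rule nn_integral_count_space_disjoint_UN) (auto simp: disjoint_family_leaves)
  also have "\<dots> \<ge> (\<Sum>i=1..N. ennreal (output_prob t i * log 2 (1 / output_prob t i)))"
    by (rule sum_mono) (rule le)
  finally show ?thesis by (simp add: shannon_entropy_def sum_ennreal nonneg)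
qed

section \<open>Building trees of small cost for dyadic distributions\<close>

abbreviation mean_bits :: "nat ddg \<Rightarrow> real" where
  "mean_bits t \<equiv> enn2real (expected_bits t)"

text \<open>As \<open>enn2real\<close> sends infinity to 0, \<open>mean_bits\<close> is the true
  cost only for such trees.\<close>

definition finite_mean :: "nat \<Rightarrow> nat ddg \<Rightarrow> bool" where
  "finite_mean N t \<longleftrightarrow> terminating N t \<and> expected_bits t < \<infinity>"

lemma finite_mean_Branch:
  assumes "finite_mean N l" "finite_mean N r"
  shows "finite_mean N (Branch l r)" "mean_bits (Branch l r) = 1 + (mean_bits l + mean_bits r) / 2"
proof -
  have lr: "terminating N l" "terminating N r" "expected_bits l = ennreal (mean_bits l)"
    "expected_bits r = ennreal (mean_bits r)"
    using assms by (auto simp: finite_mean_def less_top)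
  have "expected_bits (Branch l r) = ennreal 1 + ennreal (1/2) * (ennreal (mean_bits l) + ennreal (mean_bits r))"
    by (simp only: expected_bits_Branch[OF lr(1,2)] lr(3,4)[symmetric] ennreal_half ennreal_1)
  also have "\<dots> = ennreal (1 + (1/2) * (mean_bits l + mean_bits r))"
    by (simp only: ennreal_plus[symmetric] ennreal_mult[symmetric] enn2real_nonneg add_nonneg_nonneg
        mult_nonneg_nonneg zero_le_one zero_le_divide_1_iff zero_le_numeral)
  finally have e: "expected_bits (Branch l r) = ennreal (1 + (mean_bits l + mean_bits r) / 2)" by simp
  show "finite_mean N (Branch l r)"
    using terminating_Branch[OF lr(1,2)] by (simp add: finite_mean_def e)
  show "mean_bits (Branch l r) = 1 + (mean_bits l + mean_bits r) / 2"
    unfolding e by (rule enn2real_ennreal) (simp add: add_nonneg_nonneg)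
qed

text \<open>Neighbours in the list become the two children of a new root. Each pair costs one extra
  bit, which after doubling counts once per tree.\<close>

lemma pair_up:
  assumes "even (length ts)" "\<forall>t\<in>set ts. finite_mean N t"
  shows "\<exists>us. 2 * length us = length ts \<and> (\<forall>u\<in>set us. finite_mean N u) \<and>
    (\<forall>i. 2 * (\<Sum>u\<leftarrow>us. output_prob u i) = (\<Sum>t\<leftarrow>ts. output_prob t i)) \<and>
    2 * (\<Sum>u\<leftarrow>us. mean_bits u) = (\<Sum>t\<leftarrow>ts. mean_bits t) + real (length ts)"
  using assms
proof (induction ts rule: induct_list012)
  case (3 s t ts)
  then obtain us where us: "2 * length us = length ts" "\<forall>u\<in>set us. finite_mean N u"
    "\<forall>i. 2 * (\<Sum>u\<leftarrow>us. output_prob u i) = (\<Sum>t\<leftarrow>ts. output_prob t i)"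
    "2 * (\<Sum>u\<leftarrow>us. mean_bits u) = (\<Sum>t\<leftarrow>ts. mean_bits t) + real (length ts)"
    by auto
  show ?case
    by (rule exI[of _ "Branch s t # us"])
      (use us 3 finite_mean_Branch[of N s t] in \<open>auto simp: output_prob_Branch distrib_left\<close>)
qed auto

text \<open>\<open>bit_depth c\<close> is the sum of \<open>l * 2 ^ l\<close> over the positions \<open>l\<close> of the ones in the binary expansion
  of \<open>c\<close>; hence \<open>k * c - bit_depth c\<close> is \<open>2 ^ k\<close> times Knuth and Yao's cost of the
  probability \<open>c / 2 ^ k\<close>.\<close>

fun bit_depth :: "nat \<Rightarrow> nat" where
  "bit_depth c = (if c = 0 then 0 else 2 * bit_depth (c div 2) + 2 * (c div 2))"

declare bit_depth.simps [simp del]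

lemma bit_depth_div2: "bit_depth c = 2 * bit_depth (c div 2) + 2 * (c div 2)"
  by (cases "c = 0") (simp_all add: bit_depth.simps[of c] bit_depth.simps[of 0])

lemma bit_depth_0_1 [simp]: "bit_depth 0 = 0" "bit_depth (Suc 0) = 0"
  by (simp_all add: bit_depth.simps[of 0] bit_depth.simps[of "Suc 0"])

lemma sum_list_filter_odd:
  fixes f :: "'a \<Rightarrow> real"
  shows "(\<Sum>t\<leftarrow>map snd (filter (\<lambda>x. odd (fst x)) xs). f t) = (\<Sum>x\<leftarrow>xs. real (fst x mod 2) * f (snd x))"
  by (induction xs) (auto simp: odd_iff_mod_2_eq_one)

text \<open>Building the tree from the bottom level: subtrees of odd multiplicity are paired under a common
  parent, after which every multiplicity halves.\<close>

lemma dyadic_mixture: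
  assumes "\<forall>x\<in>set xs. finite_mean N (snd x)" "(\<Sum>x\<leftarrow>xs. fst x) = 2 ^ k"
  shows "\<exists>t. finite_mean N t \<and>
    (\<forall>i. 2 ^ k * output_prob t i = (\<Sum>x\<leftarrow>xs. real (fst x) * output_prob (snd x) i)) \<and>
    2 ^ k * mean_bits t =
      (\<Sum>x\<leftarrow>xs. real k * real (fst x) - real (bit_depth (fst x)) + real (fst x) * mean_bits (snd x))"
  using assms
proof (induction k arbitrary: xs)
  case 0
  then have "(\<Sum>x\<leftarrow>xs. fst x) = 1" by simp
  \<comment> \<open>Multiplicities with sum 1 single out one tree; all others have multiplicity 0,
    and \<open>bit_depth\<close> vanishes at 0 and 1.\<close>
  then obtain t where t: "(1, t) \<in> set xs"
    and f: "\<And>g. (\<Sum>x\<leftarrow>xs. real (fst x) * g (snd x)) = g t" "(\<Sum>x\<leftarrow>xs. real (bit_depth (fst x))) = 0"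
  proof (induction xs arbitrary: thesis)
    case (Cons x xs)
    show ?case
    proof (cases "fst x = 0")
      case True
      then have "(\<Sum>x\<leftarrow>xs. fst x) = 1" using Cons.prems(2) by simp
      then show ?thesis using Cons.IH Cons.prems(1) True by auto
    next
      case False
      have "fst x + (\<Sum>y\<leftarrow>xs. fst y) = 1" using Cons.prems(2) by simp
      with False have x: "fst x = 1" and "(\<Sum>y\<leftarrow>xs. fst y) = 0" by linarith+
      then have "\<forall>y\<in>set xs. fst y = 0" by (auto simp: sum_list_eq_0_iff)
      moreover have "(1, snd x) \<in> set (x # xs)" using x by (simp add: prod_eq_iff)
      moreover note x
      ultimately show ?thesis
        by (intro Cons.prems(1)[of "snd x"]) (auto simp: sum_list_0 cong: map_cong)
    qed
  qed simp
  show ?case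
    by (rule exI[of _ t]) (use 0(1) t f(1)[of "\<lambda>t. output_prob t _"] f(1)[of mean_bits] f(2) in
      \<open>auto simp: sum_list_addf sum_list_subtractf\<close>)
next
  case (Suc k)
  let ?ts = "map snd (filter (\<lambda>x. odd (fst x)) xs)"
  have len: "real (length ?ts) = (\<Sum>x\<leftarrow>xs. real (fst x mod 2))"
    using sum_list_filter_odd[of "\<lambda>_. 1" xs] by (simp add: sum_list_triv)
  \<comment> \<open>The total is even, so the number of odd multiplicities is even and their trees
    can be paired.\<close>
  have total: "2 * (\<Sum>x\<leftarrow>xs. fst x div 2) + length ?ts = (\<Sum>x\<leftarrow>xs. fst x)"
    by (induction xs) (auto, presburger+)
  then have "even (length ?ts)" using Suc.prems(2) by (metis even_add even_mult_iff even_numeral power_Suc)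
  then obtain us where us: "2 * length us = length ?ts" "\<forall>u\<in>set us. finite_mean N u"
    "\<forall>i. 2 * (\<Sum>u\<leftarrow>us. output_prob u i) = (\<Sum>t\<leftarrow>?ts. output_prob t i)"
    "2 * (\<Sum>u\<leftarrow>us. mean_bits u) = (\<Sum>t\<leftarrow>?ts. mean_bits t) + real (length ?ts)"
    using pair_up[of ?ts N] Suc.prems(1) by auto
  \<comment> \<open>Old trees keep half their multiplicity, rounded down; each new pair enters with
    multiplicity 1.\<close>
  let ?ys = "map (\<lambda>x. (fst x div 2, snd x)) xs @ map (Pair 1) us"
  have "(\<Sum>x\<leftarrow>?ys. fst x) = 2 ^ k"
    using total us(1) Suc.prems(2) by (simp add: o_def sum_list_triv)
  moreover have "\<forall>x\<in>set ?ys. finite_mean N (snd x)" using Suc.prems(1) us(2) by auto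
  ultimately obtain t where t: "finite_mean N t"
    "\<And>i. 2 ^ k * output_prob t i = (\<Sum>x\<leftarrow>?ys. real (fst x) * output_prob (snd x) i)"
    "2 ^ k * mean_bits t =
      (\<Sum>x\<leftarrow>?ys. real k * real (fst x) - real (bit_depth (fst x)) + real (fst x) * mean_bits (snd x))"
    using Suc.IH[of ?ys] by blast
  have split: "real c = 2 * real (c div 2) + real (c mod 2)" for c
    using div_mult_mod_eq[of c 2] by (metis mult.commute of_nat_add of_nat_mult of_nat_numeral)
  have "2 ^ Suc k * output_prob t i = (\<Sum>x\<leftarrow>xs. real (fst x) * output_prob (snd x) i)" for i
  proof -
    have "2 ^ Suc k * output_prob t i = 2 * (\<Sum>x\<leftarrow>xs. real (fst x div 2) * output_prob (snd x) i)
        + 2 * (\<Sum>u\<leftarrow>us. output_prob u i)"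
      using t(2)[of i] by (simp add: o_def)
    also have "\<dots> = (\<Sum>x\<leftarrow>xs. 2 * (real (fst x div 2) * output_prob (snd x) i)
        + real (fst x mod 2) * output_prob (snd x) i)"
      unfolding us(3)[rule_format] sum_list_filter_odd by (simp add: sum_list_addf sum_list_const_mult)
    also have "\<dots> = (\<Sum>x\<leftarrow>xs. real (fst x) * output_prob (snd x) i)"
      by (intro arg_cong[of _ _ sum_list] map_cong refl) (subst (3) split, simp add: algebra_simps)
    finally show ?thesis .
  qed
  moreover have "2 ^ Suc k * mean_bits t = (\<Sum>x\<leftarrow>xs. real (Suc k) * real (fst x)
      - real (bit_depth (fst x)) + real (fst x) * mean_bits (snd x))"
  proof -
    let ?f = "\<lambda>x. real k * real (fst x div 2) - real (bit_depth (fst x div 2))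
      + real (fst x div 2) * mean_bits (snd x)"
    have "2 ^ Suc k * mean_bits t = 2 * (\<Sum>x\<leftarrow>xs. ?f x)
        + (real k * real (2 * length us) + 2 * (\<Sum>u\<leftarrow>us. mean_bits u))"
      unfolding power_Suc mult.assoc t(3) by (simp add: o_def sum_list_addf sum_list_triv algebra_simps)
    \<comment> \<open>The extra bits from pairing raise the coefficient of \<open>length ?ts\<close>
      from \<open>k\<close> to \<open>Suc k\<close>.\<close>
    also have "\<dots> = 2 * (\<Sum>x\<leftarrow>xs. ?f x) + (real (Suc k) * real (length ?ts) + (\<Sum>t\<leftarrow>?ts. mean_bits t))"
      unfolding us(1,4) by (simp add: algebra_simps)
    also have "\<dots> = (\<Sum>x\<leftarrow>xs. 2 * ?f x + (real (Suc k) * real (fst x mod 2)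
        + real (fst x mod 2) * mean_bits (snd x)))"
      unfolding len sum_list_filter_odd by (simp only: sum_list_addf sum_list_const_mult)
    also have "\<dots> = (\<Sum>x\<leftarrow>xs. real (Suc k) * real (fst x)
        - real (bit_depth (fst x)) + real (fst x) * mean_bits (snd x))"
    proof (intro arg_cong[of _ _ sum_list] map_cong refl)
      fix x :: "nat \<times> nat ddg"
      have b: "real (bit_depth (fst x)) = 2 * real (bit_depth (fst x div 2)) + 2 * real (fst x div 2)"
        by (subst bit_depth_div2) simp
      show "2 * ?f x + (real (Suc k) * real (fst x mod 2) + real (fst x mod 2) * mean_bits (snd x))
        = real (Suc k) * real (fst x) - real (bit_depth (fst x)) + real (fst x) * mean_bits (snd x)"
        unfolding b split[of "fst x"] by (simp add: algebra_simps)
    qed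
    finally show ?thesis .
  qed
  ultimately show ?case using t(1) by blast
qed

subsection \<open>Logarithmic estimates\<close>

text \<open>Bernoulli's inequality gives \<open>2 \<le> (1 + 1 / n) ^ n\<close>, so \<open>n\<close>
  times the increment of the logarithm is at least 1; the other 1 comes from
  \<open>log 2 (n + 1) \<ge> 1\<close>.\<close>

lemma log_step:
  assumes "n \<ge> 1"
  shows "2 \<le> (real n + 1) * log 2 (real n + 1) - real n * log 2 (real n)"
proof -
  have "2 \<le> (1 + 1 / real n) ^ n"
    using Bernoulli_inequality[of "1 / real n" n] assms by (simp add: order_trans[of "-1" 0])
  then have "log 2 2 \<le> log 2 ((1 + 1 / real n) ^ n)" by (subst log_le_cancel_iff) auto
  also have "\<dots> = real n * log 2 (1 + 1 / real n)"
    using assms by (intro log_nat_power) (auto intro: add_pos_nonneg)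
  also have "1 + 1 / real n = (real n + 1) / real n" using assms by (simp add: field_simps)
  also have "log 2 \<dots> = log 2 (real n + 1) - log 2 (real n)" using assms by (simp add: log_divide)
  finally have "1 \<le> real n * log 2 (real n + 1) - real n * log 2 (real n)" by (simp add: algebra_simps)
  moreover have "1 \<le> log 2 (real n + 1)" using assms by simp
  ultimately show ?thesis unfolding distrib_right mult_1_left by linarith
qed

text \<open>The bound by \<open>c * log 2 c\<close> is not inductive under \<open>c \<mapsto> 2 * c + 1\<close>. With \<open>c + 1\<close> it is, and holds
  with equality when all binary digits of \<open>c\<close> are one.\<close>

lemma bit_depth_ge: "(real c + 1) * log 2 (real c + 1) - 2 * real c \<le> real (bit_depth c)"
proof (induction c rule: less_induct)
  case (less c)
  show ?case
  proof (cases "c = 0")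
    case False
    define d where "d = c div 2"
    have "d < c" using False by (simp add: d_def)
    from less[OF this] have IH: "(real d + 1) * log 2 (real d + 1) - 2 * real d \<le> real (bit_depth d)" .
    have b: "real (bit_depth c) = 2 * real (bit_depth d) + 2 * real d"
      unfolding d_def by (subst bit_depth_div2) simp
    have "log 2 (2 * (real d + 1)) = 1 + log 2 (real d + 1)" by (subst log_mult) auto
    then have l: "log 2 (2 * real d + 2) = 1 + log 2 (real d + 1)" by (simp add: algebra_simps)
    have "c = 2 * d \<or> c = 2 * d + 1" unfolding d_def by presburger
    then consider "c = 2 * d" | "c = 2 * d + 1" by blast
    then show ?thesis
    proof cases
      case 1
      \<comment> \<open>The induction hypothesis yields the logarithmic term at
        \<open>2 * d + 2\<close> instead of \<open>2 * d + 1\<close>, with a deficit of exactly the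
        2 that \<open>log_step\<close> supplies.\<close>
      have "(2 * real d + 1) * log 2 (2 * real d + 1) + 2 \<le> (2 * real d + 2) * log 2 (2 * real d + 2)"
        using log_step[of "2 * d + 1"] by (simp add: add.commute)
      then show ?thesis unfolding b l using IH 1 by (simp add: algebra_simps)
    next
      case 2
      then have c1: "real c + 1 = 2 * real d + 2" by simp
      show ?thesis unfolding b c1 l using IH 2 by (simp add: algebra_simps)
    qed
  qed simp
qed

text \<open>In this form the cost \<open>k * c - bit_depth c\<close> is at most
  \<open>c * (k - log 2 c) + 2 * c\<close>: the entropy term of the probability
  \<open>c / 2 ^ k\<close> plus two bits, both scaled by \<open>2 ^ k\<close>.\<close>

lemma bit_depth_ge_entropy: "real c * log 2 (real c) - 2 * real c \<le> real (bit_depth c)"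
proof (cases "c = 0")
  case False
  have "real c * log 2 (real c) \<le> (real c + 1) * log 2 (real c + 1)"
    using log_step[of c] False by simp
  then show ?thesis using bit_depth_ge[of c] by simp
qed simp

text \<open>The mixture starts from single leaves, which cost nothing. Divided by
  \<open>2 ^ k\<close>, the bound is the entropy plus 2. Zero weights are allowed, as the restart
  weight vanishes when \<open>m\<close> is a power of two.\<close>

lemma dyadic_tree:
  assumes "(\<Sum>i=1..N. c i) = 2 ^ k"
  obtains t where "finite_mean N t" "\<And>i. i \<in> {1..N} \<Longrightarrow> output_prob t i = real (c i) / 2 ^ k"
    "2 ^ k * mean_bits t \<le> (\<Sum>i=1..N. real (c i) * (real k + 2 - log 2 (real (c i))))"
proof -
  let ?xs = "map (\<lambda>i. (c i, Leaf i)) [1..<Suc N]"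
  have sum: "(\<Sum>x\<leftarrow>?xs. g x) = (\<Sum>i=1..N. g (c i, Leaf i))"
    for g :: "nat \<times> nat ddg \<Rightarrow> 'b::comm_monoid_add"
    by (simp add: o_def interv_sum_list_conv_sum_set_nat atLeastLessThanSuc_atLeastAtMost del: upt_Suc)
  have "finite_mean N (Leaf i)" if "i \<in> {1..N}" for i
    using terminating_Leaf[OF that] expected_bits_Leaf[OF that] by (simp add: finite_mean_def)
  then have "\<forall>x\<in>set ?xs. finite_mean N (snd x)" by auto
  from dyadic_mixture[OF this] obtain t where t: "finite_mean N t"
    "\<And>i. 2 ^ k * output_prob t i = (\<Sum>x\<leftarrow>?xs. real (fst x) * output_prob (snd x) i)"
    "2 ^ k * mean_bits t =
      (\<Sum>x\<leftarrow>?xs. real k * real (fst x) - real (bit_depth (fst x)) + real (fst x) * mean_bits (snd x))"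
    using assms unfolding sum by auto
  show ?thesis
  proof
    show "finite_mean N t" by (rule t(1))
    show "output_prob t i = real (c i) / 2 ^ k" if "i \<in> {1..N}" for i
    proof -
      have "2 ^ k * output_prob t i = (\<Sum>j=1..N. if i = j then real (c j) else 0)"
        unfolding t(2) sum by (intro sum.cong) (auto simp: output_prob_Leaf)
      also have "\<dots> = real (c i)" using that by simp
      finally show ?thesis by (simp add: field_simps)
    qed
    show "2 ^ k * mean_bits t \<le> (\<Sum>i=1..N. real (c i) * (real k + 2 - log 2 (real (c i))))"
      unfolding t(3) sum
    proof (rule sum_mono)
      fix i assume "i \<in> {1..N}"
      then have "expected_bits (Leaf i) = 0" by (rule expected_bits_Leaf)
      then show "real k * real (fst (c i, Leaf i)) - real (bit_depth (fst (c i, Leaf i)))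
          + real (fst (c i, Leaf i)) * mean_bits (snd (c i, Leaf i))
        \<le> real (c i) * (real k + 2 - log 2 (real (c i)))"
        using bit_depth_ge_entropy[of "c i"] by (simp add: algebra_simps)
    qed
  qed
qed

lemma binary_entropy_le:
  fixes x y :: real
  assumes "0 < x" "0 \<le> y"
  shows "x * (log 2 (x + y) - log 2 x) + y * (log 2 (x + y) - log 2 y) \<le> x + y"
proof -
  \<comment> \<open>This is \<open>ln u \<le> u - 1\<close> at \<open>u = (x + y) / (2 * z)\<close>,
    tight at the even split \<open>z = (x + y) / 2\<close>. The error terms for \<open>x\<close> and
    \<open>y\<close> cancel.\<close>
  have *: "z * (log 2 (x + y) - log 2 z) \<le> z + ((x + y) / 2 - z) / ln 2" if "0 \<le> z" for z
  proof (cases "z = 0")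
    case False
    with that have z: "0 < z" by simp
    have "ln ((x + y) / (2 * z)) \<le> (x + y) / (2 * z) - 1" using assms z by (intro ln_le_minus_one) simp
    then have "z * ln ((x + y) / (2 * z)) \<le> z * ((x + y) / (2 * z) - 1)" using z by (intro mult_left_mono) auto
    also have "\<dots> = (x + y) / 2 - z" using z by (simp add: field_simps)
    finally have "z * (ln ((x + y) / (2 * z)) / ln 2) \<le> ((x + y) / 2 - z) / ln 2"
      by (simp add: divide_right_mono)
    moreover have "ln ((x + y) / (2 * z)) / ln 2 = log 2 (x + y) - log 2 z - 1"
      using assms z by (simp add: log_def ln_div ln_mult field_simps)
    ultimately have "z * (log 2 (x + y) - log 2 z - 1) \<le> ((x + y) / 2 - z) / ln 2" by (simp only:)
    then show ?thesis by (simp add: algebra_simps)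
  qed (use assms in simp)
  have "((x + y) / 2 - x) / ln 2 + ((x + y) / 2 - y) / ln 2 = 0" by (simp add: field_simps)
  then show ?thesis using *[of x] *[of y] assms by simp
qed

subsection \<open>The toll of the Fast Loaded Dice Roller\<close>

theorem theorem5p2:
  fixes n :: nat and a :: "nat \<Rightarrow> nat" and p :: "nat \<Rightarrow> real" and Tq T :: "nat ddg"
  assumes "n \<ge> 1"
    and "\<forall>i\<in>{1..n}. a i > 0"
    and "p = (\<lambda>i. real (a i) / real (\<Sum>j=1..n. a j))"
    and "entropy_optimal (n + 1) (fldr_proposal n a) Tq"
    and "T = fldr_tree n Tq"
  shows "expected_bits T < \<infinity>
    \<and> 0 \<le> enn2real (expected_bits T) - shannon_entropy n p
    \<and> enn2real (expected_bits T) - shannon_entropy n p < 6"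
proof -
  define m where "m = (\<Sum>j=1..n. a j)"
  define k where "k = nat \<lceil>log 2 (real m)\<rceil>"
  \<comment> \<open>These are the integer numerators of the proposal over \<open>2 ^ k\<close>; the
    natural subtraction is exact once \<open>m \<le> 2 ^ k\<close> is known.\<close>
  define c where "c i = (if i \<le> n then a i else 2 ^ k - m)" for i
  have p: "p = (\<lambda>i. real (a i) / real m)" by (simp add: assms(3) m_def)
  have "a 1 \<le> m" unfolding m_def using assms(1) by (intro member_le_sum) auto
  moreover have "0 < a 1" using assms(1,2) by simp
  ultimately have m: "1 \<le> m" by linarith
  \<comment> \<open>Nonnegativity ensures that \<open>nat\<close> does not alter the
    ceiling.\<close>
  have "0 \<le> log 2 (real m)" using m by simp
  then have k: "log 2 (real m) \<le> real k" "real k < log 2 (real m) + 1"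
    unfolding k_def by linarith+
  have "2 powr log 2 (real m) \<le> 2 powr real k" using k(1) by simp
  then have mQ: "real m \<le> 2 ^ k" using m by (simp add: powr_realpow)
  have "2 powr real k < 2 powr (log 2 (real m) + 1)" using k(2) by simp
  then have Qm: "2 ^ k < 2 * real m" using m by (simp add: powr_realpow powr_add)
  have mQ': "m \<le> 2 ^ k" using mQ by (metis of_nat_le_iff of_nat_numeral of_nat_power)
  have c_restart: "real (c (Suc n)) = 2 ^ k - real m" using mQ' by (simp add: c_def of_nat_diff)
  have c_sum: "(\<Sum>i=1..Suc n. c i) = 2 ^ k"
  proof -
    have "(\<Sum>i=1..n. c i) = m" unfolding m_def by (intro sum.cong) (auto simp: c_def)
    then show ?thesis using mQ' by (simp add: c_def)
  qed
  have proposal: "fldr_proposal n a i = (if i \<le> n then real (a i) / 2 ^ k else 1 - real m / 2 ^ k)" for i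
    by (simp only: fldr_proposal_def Let_def m_def k_def)
  have q: "fldr_proposal n a i = real (c i) / 2 ^ k" if "i \<in> {1..Suc n}" for i
  proof (cases "i \<le> n")
    case False
    with that have "i = Suc n" by simp
    then show ?thesis
      using c_restart by (simp add: proposal diff_divide_distrib)
  qed (simp add: proposal c_def)
  have opt: "labels Tq \<subseteq> {1..Suc n}" "\<And>i. i \<in> {1..Suc n} \<Longrightarrow> output_prob Tq i = real (c i) / 2 ^ k"
    "\<And>t. labels t \<subseteq> {1..Suc n} \<Longrightarrow> (\<And>i. i \<in> {1..Suc n} \<Longrightarrow> output_prob t i = real (c i) / 2 ^ k) \<Longrightarrow>
      expected_bits Tq \<le> expected_bits t"
    using assms(4) q by (simp_all add: entropy_optimal_def)
  have "(\<Sum>i=1..Suc n. real (c i)) = 2 ^ k" using arg_cong[OF c_sum, of real] by simp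
  then have Tq: "terminating (Suc n) Tq"
    using opt(1,2) by (simp add: terminating_def flip: sum_divide_distrib add_divide_distrib)
  have r: "output_prob Tq (Suc n) = 1 - real m / 2 ^ k"
    using opt(2)[of "Suc n"] c_restart by (simp add: diff_divide_distrib)
  then have r1: "output_prob Tq (Suc n) < 1" using m by simp
  then have neq: "Tq \<noteq> Leaf (Suc n)" by (auto simp: output_prob_Leaf)
  obtain t where t: "finite_mean (Suc n) t" "\<And>i. i \<in> {1..Suc n} \<Longrightarrow> output_prob t i = real (c i) / 2 ^ k"
    "2 ^ k * mean_bits t \<le> (\<Sum>i=1..Suc n. real (c i) * (real k + 2 - log 2 (real (c i))))"
    using dyadic_tree[OF c_sum] by blast
  have le: "expected_bits Tq \<le> expected_bits t" using opt(3)[of t] t(1,2) by (simp add: finite_mean_def terminating_def)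
  have fin: "expected_bits t < \<top>" using t(1) by (simp add: finite_mean_def)
  \<comment> \<open>Monotonicity of \<open>enn2real\<close> needs the larger cost to be finite,
    which the constructed tree provides.\<close>
  have mean: "mean_bits Tq \<le> mean_bits t" using le fin by (rule enn2real_mono)
  have Tq_fin: "expected_bits Tq < \<infinity>" using le fin by simp
  have T: "T = restart (Suc n) Tq Tq" using assms(5) by (simp add: fldr_tree_def)
  have ET: "expected_bits T = ennreal (mean_bits Tq / (1 - output_prob Tq (Suc n)))"
    unfolding T by (rule expected_bits_restart[OF Tq neq r1 Tq_fin])
  have "output_prob T i = p i" if "i \<in> {1..n}" for i
    using that opt(2)[of i] by (simp add: T output_prob_restart[OF _ r1] r p c_def)
  then have "shannon_entropy n (output_prob T) = shannon_entropy n p"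
    by (simp add: shannon_entropy_def)
  then have lower: "ennreal (shannon_entropy n p) \<le> expected_bits T"
    using entropy_le_expected_bits[OF terminating_restart[OF Tq neq r1]] by (simp add: T)
  have mean_T: "real m * mean_bits T = 2 ^ k * mean_bits Tq"
    unfolding ET r using m by (simp add: enn2real_mult)
  have H: "real m * shannon_entropy n p = (\<Sum>i=1..n. real (a i) * (log 2 (real m) - log 2 (real (a i))))"
    unfolding shannon_entropy_def sum_distrib_left
  proof (rule sum.cong)
    fix i assume "i \<in> {1..n}"
    then have "0 < a i" using assms(2) by simp
    then show "real m * (p i * log 2 (1 / p i)) = real (a i) * (log 2 (real m) - log 2 (real (a i)))"
      using m by (simp add: p log_divide)
  qed simp
  have sum_a: "(\<Sum>i=1..n. real (a i)) = real m" by (simp add: m_def)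
  have "real m * mean_bits T \<le> 2 ^ k * mean_bits t" unfolding mean_T using mean by simp
  also have "\<dots> \<le> (\<Sum>i=1..n. real (c i) * (real k + 2 - log 2 (real (c i))))
      + (2 ^ k - real m) * (real k + 2 - log 2 (2 ^ k - real m))"
    using t(3) c_restart by simp
  \<comment> \<open>Inserting \<open>log 2 m\<close> splits off the entropy of \<open>p\<close>; the
    rest is linear in \<open>a i\<close> and sums to a multiple of \<open>m\<close>.\<close>
  also have "(\<Sum>i=1..n. real (c i) * (real k + 2 - log 2 (real (c i))))
      = (\<Sum>i=1..n. real (a i) * (log 2 (real m) - log 2 (real (a i))) + real (a i) * (real k + 2 - log 2 (real m)))"
    by (intro sum.cong) (auto simp: c_def algebra_simps)
  also have "\<dots> = real m * shannon_entropy n p + real m * (real k + 2 - log 2 (real m))"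
    unfolding H sum.distrib sum_distrib_right[symmetric] sum_a ..
  finally have "real m * (mean_bits T - shannon_entropy n p)
      \<le> real m * (real k - log 2 (real m)) + (2 ^ k - real m) * (real k - log 2 (2 ^ k - real m)) + 2 * 2 ^ k"
    by (simp add: algebra_simps)
  \<comment> \<open>The first two terms are \<open>2 ^ k\<close> times the binary entropy of
    \<open>m / 2 ^ k\<close>, because \<open>k = log 2 (2 ^ k)\<close>. The last is the two-bit
    overhead of the constructed tree.\<close>
  also have "\<dots> \<le> 2 ^ k + 2 * 2 ^ k"
    using binary_entropy_le[of "real m" "2 ^ k - real m"] m mQ by (simp add: log_nat_power)
  also have "\<dots> < real m * 6" using Qm by simp
  finally have upper: "mean_bits T - shannon_entropy n p < 6" using m by simp
  have "ennreal (shannon_entropy n p) \<le> ennreal (mean_bits T)" using lower by (simp add: ET)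
  then have "shannon_entropy n p \<le> mean_bits T" by (simp only: ennreal_le_iff enn2real_nonneg)
  with upper show ?thesis by (simp add: ET)
qed

end
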